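(* Let $D$ be a (finite, nonempty) connected simple digraph. Then the following statements are equivalent: (i) $D\in\Gamma_{\leq 1}$, i.e. $\gamma(D)\leq 1$; (ii) $D$ is $\mathfrak F$-free; (iii) $D$ is isomorphic to $\Lambda_{n_1,n_2,n_3}$ for some natural numbers $n_1,n_2,n_3\geq 0$.
   Context: Digraphs are finite and have no loops. A digraph is connected if its underlying undirected graph is connected. A digraph is simple if for each ordered pair $(u,v)$ of distinct vertices there is at most one arc from $u$ to $v$ (both arcs $u\to v$ and $v\to u$ may be present). For a digraph $D$ with vertex set $V(D)$ and indeterminates $X_D=\{x_u : u\in V(D)\}$, the generalized Laplacian matrix $L(D,X_D)$ has rows and columns indexed by $V(D)$, with $L(D,X_D)_{uu}=x_u$ and $L(D,X_D)_{uv}=-m_{uv}$ for $u\neq v$, where $m_{uv}$ is the number of arcs from $u$ to $v$. For $1\leq i\leq |V(D)|$, the $i$-th critical ideal $I_i(D,X_D)\subseteq\mathbb{Z}[X_D]$ is the ideal generated by the determinants of all $i\times i$ submatrices of $L(D,X_D)$. It is called trivial if it equals $\langle 1\rangle$. The algebraic co-rank $\gamma(D)$ is the number of trivial critical ideals of $D$. $\Gamma_{\leq i}$ is the set of simple connected digraphs $D$ with $\gamma(D)\leq i$. A digraph is $\mathfrak F$-free if none of its induced subdigraphs is isomorphic to a member of $\mathfrak F$. The family $\mathfrak F$ consists of the following 17 digraphs, where $i\to j$ denotes a single arc and $i\leftrightarrow j$ denotes both arcs $i\to j$ and $j\to i$, and there are no arcs other than those listed. On the vertex set $\{1,2,3\}$: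 $F_{3,1}$: $1\to3,\ 3\to2$. $F_{3,2}$: $1\leftrightarrow3,\ 2\to3$. $F_{3,3}$: $1\leftrightarrow3,\ 3\to2$. $F_{3,4}$: $1\leftrightarrow3,\ 2\leftrightarrow3$. $F_{3,5}$: $1\to2,\ 2\to3,\ 3\to1$. $F_{3,6}$: $1\leftrightarrow2,\ 1\to3,\ 3\to2$. $F_{3,7}$: $1\leftrightarrow2,\ 1\leftrightarrow3,\ 2\to3$. On the vertex set $\{1,2,3,4\}$: $F_{4,1}$: $1\to3,\ 1\to4,\ 2\to4$. $F_{4,2}$: $1\to3,\ 1\to4,\ 2\to4,\ 3\to4$. $F_{4,3}$: $1\to3,\ 4\to1,\ 4\to2,\ 4\to3$. $F_{4,4}$: $1\leftrightarrow3,\ 1\to4,\ 2\to4,\ 3\to4$. $F_{4,5}$: $1\leftrightarrow3,\ 4\to1,\ 4\to2,\ 4\to3$. $F_{4,6}$: $1\to3,\ 2\to3,\ 4\to1,\ 4\to2,\ 4\to3$. $F_{4,7}$: $1\to2,\ 1\to3,\ 1\to4,\ 2\to3,\ 2\to4,\ 3\to4$. $F_{4,8}$: $1\leftrightarrow2,\ 1\to3,\ 1\to4,\ 2\to3,\ 2\to4,\ 3\to4$. $F_{4,9}$: $1\leftrightarrow2,\ 1\to3,\ 1\to4,\ 2\to3,\ 2\to4,\ 3\leftrightarrow4$. $F_{4,10}$: $1\leftrightarrow2,\ 3\to1,\ 3\to2,\ 3\to4,\ 4\to1,\ 4\to2$. For integers $n_1,n_2,n_3\geq0$, $\Lambda_{n_1,n_2,n_3}$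 is the simple digraph whose vertex set is partitioned into three sets $T,K,T'$ of sizes $n_1,n_2,n_3$ respectively, and whose arcs are exactly: both arcs between every pair of distinct vertices of $K$; every arc from a vertex of $T$ to a vertex of $K$; every arc from a vertex of $T$ to a vertex of $T'$; and every arc from a vertex of $K$ to a vertex of $T'$. (There are no arcs inside $T$ or inside $T'$.) *)

theory Defs
  imports
    "Graph_Theory.Graph_Theory"
    "Jordan_Normal_Form.Determinant"
    "HOL-Algebra.Ideal"
    "HOL-Library.Poly_Mapping"
begin

text \<open>
  Polynomials over the integers in the indeterminates \<open>x_u\<close>, where \<open>u\<close> ranges over the type
  \<open>'a\<close>, are finitely supported maps from monomials to coefficients; a monomial is a finitely
  supported map from indeterminates to exponents.
\<close>
type_synonym 'a int_mpoly = "('a \<Rightarrow>\<^sub>0 nat) \<Rightarrow>\<^sub>0 int"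

definition indet :: "'a \<Rightarrow> 'a int_mpoly" where
  "indet u = Poly_Mapping.single (Poly_Mapping.single u 1) 1"

text \<open>The ring \<open>\<int>[X]\<close> with \<open>X = {x_u | u \<in> V}\<close>: only the indeterminates of \<open>V\<close> may occur.\<close>
definition int_poly_ring :: "'a set \<Rightarrow> 'a int_mpoly ring" where
  "int_poly_ring V =
    \<lparr>carrier = {p. \<forall>m \<in> Poly_Mapping.keys p. Poly_Mapping.keys m \<subseteq> V},
     mult = (*), one = 1, zero = 0, add = (+)\<rparr>"

definition arc_mult :: "('a, 'b) pre_digraph \<Rightarrow> 'a \<Rightarrow> 'a \<Rightarrow> nat" where
  "arc_mult D u v = card {e \<in> arcs D. tail D e = u \<and> head D e = v}"

definition gen_laplacian :: "('a, 'b) pre_digraph \<Rightarrow> 'a \<Rightarrow> 'a \<Rightarrow> 'a int_mpoly" where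
  "gen_laplacian D u v = (if u = v then indet u else - of_nat (arc_mult D u v))"

text \<open>
  A submatrix is selected by a list of distinct rows and a list of distinct columns. The vertices
  carry no order, so all orderings of the selected rows and columns occur; reordering
  changes a minor at most by its sign.
\<close>
definition laplacian_minor :: "('a, 'b) pre_digraph \<Rightarrow> 'a list \<Rightarrow> 'a list \<Rightarrow> 'a int_mpoly" where
  "laplacian_minor D rs cs =
    Determinant.det (mat (length rs) (length cs) (\<lambda>(a, b). gen_laplacian D (rs ! a) (cs ! b)))"

definition laplacian_minors :: "('a, 'b) pre_digraph \<Rightarrow> nat \<Rightarrow> 'a int_mpoly set" where
  "laplacian_minors D i =
    {laplacian_minor D rs cs | rs cs.
       distinct rs \<and> set rs \<subseteq> verts D \<and> length rs = i \<and>
       distinct cs \<and> set cs \<subseteq> verts D \<and> length cs = i}"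

definition critical_ideal :: "('a, 'b) pre_digraph \<Rightarrow> nat \<Rightarrow> 'a int_mpoly set" where
  "critical_ideal D i = Idl\<^bsub>int_poly_ring (verts D)\<^esub> (laplacian_minors D i)"

definition trivial_critical_ideal :: "('a, 'b) pre_digraph \<Rightarrow> nat \<Rightarrow> bool" where
  "trivial_critical_ideal D i \<longleftrightarrow>
    critical_ideal D i = Idl\<^bsub>int_poly_ring (verts D)\<^esub> {\<one>\<^bsub>int_poly_ring (verts D)\<^esub>}"

definition algebraic_corank :: "('a, 'b) pre_digraph \<Rightarrow> nat" where
  "algebraic_corank D = card {i \<in> {1..card (verts D)}. trivial_critical_ideal D i}"

text \<open>
  The locale \<open>digraph\<close> describes finite digraphs without loops or parallel arcs; opposite arcs are
  allowed. Connectedness is that of the underlying undirected graph and excludes the null graph.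
\<close>
definition Gamma_le :: "nat \<Rightarrow> ('a, 'b) pre_digraph set" where
  "Gamma_le i = {D. digraph D \<and> Digraph_Component.connected D \<and> algebraic_corank D \<le> i}"

definition family_free :: "('c, 'd) pre_digraph set \<Rightarrow> ('a, 'b) pre_digraph \<Rightarrow> bool" where
  "family_free \<F> D \<longleftrightarrow> \<not> (\<exists>H F. induced_subgraph H D \<and> F \<in> \<F> \<and> digraph_iso H F)"

definition arcs_digraph :: "nat set \<Rightarrow> (nat \<times> nat) set \<Rightarrow> (nat, nat \<times> nat) pre_digraph" where
  "arcs_digraph V A = \<lparr>verts = V, arcs = A, tail = fst, head = snd\<rparr>"

definition forbidden_family :: "(nat, nat \<times> nat) pre_digraph set" where
  "forbidden_family =
    {arcs_digraph {1..3} {(1,3), (3,2)},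
     arcs_digraph {1..3} {(1,3), (3,1), (2,3)},
     arcs_digraph {1..3} {(1,3), (3,1), (3,2)},
     arcs_digraph {1..3} {(1,3), (3,1), (2,3), (3,2)},
     arcs_digraph {1..3} {(1,2), (2,3), (3,1)},
     arcs_digraph {1..3} {(1,2), (2,1), (1,3), (3,2)},
     arcs_digraph {1..3} {(1,2), (2,1), (1,3), (3,1), (2,3)},
     arcs_digraph {1..4} {(1,3), (1,4), (2,4)},
     arcs_digraph {1..4} {(1,3), (1,4), (2,4), (3,4)},
     arcs_digraph {1..4} {(1,3), (4,1), (4,2), (4,3)},
     arcs_digraph {1..4} {(1,3), (3,1), (1,4), (2,4), (3,4)},
     arcs_digraph {1..4} {(1,3), (3,1), (4,1), (4,2), (4,3)},
     arcs_digraph {1..4} {(1,3), (2,3), (4,1), (4,2), (4,3)},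
     arcs_digraph {1..4} {(1,2), (1,3), (1,4), (2,3), (2,4), (3,4)},
     arcs_digraph {1..4} {(1,2), (2,1), (1,3), (1,4), (2,3), (2,4), (3,4)},
     arcs_digraph {1..4} {(1,2), (2,1), (1,3), (1,4), (2,3), (2,4), (3,4), (4,3)},
     arcs_digraph {1..4} {(1,2), (2,1), (3,1), (3,2), (3,4), (4,1), (4,2)}}"

definition Lambda :: "nat \<Rightarrow> nat \<Rightarrow> nat \<Rightarrow> (nat, nat \<times> nat) pre_digraph" where
  "Lambda n1 n2 n3 =
    (let T = {..<n1}; K = {n1..<n1 + n2}; T' = {n1 + n2..<n1 + n2 + n3}
     in arcs_digraph (T \<union> K \<union> T')
          ({(u, v). u \<in> K \<and> v \<in> K \<and> u \<noteq> v} \<union> T \<times> K \<union> T \<times> T' \<union> K \<times> T'))"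

text \<open>
  Outside a ring, or for generators outside its carrier, \<open>genideal\<close> degenerates to an empty
  intersection; the following facts rule this out.
\<close>
lemma carrier_int_poly_ring:
  "carrier (int_poly_ring V) = {p. \<forall>m \<in> Poly_Mapping.keys p. Poly_Mapping.keys m \<subseteq> V}"
  by (simp add: int_poly_ring_def)

lemma int_poly_ring_ops:
  "\<zero>\<^bsub>int_poly_ring V\<^esub> = 0" "\<one>\<^bsub>int_poly_ring V\<^esub> = 1"
  "p \<oplus>\<^bsub>int_poly_ring V\<^esub> q = p + q" "p \<otimes>\<^bsub>int_poly_ring V\<^esub> q = p * q"
  by (simp_all add: int_poly_ring_def)

lemma int_poly_ring_zero_closed: "0 \<in> carrier (int_poly_ring V)"
  by (simp add: carrier_int_poly_ring)

lemma int_poly_ring_one_closed: "1 \<in> carrier (int_poly_ring V)"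
  by (simp add: carrier_int_poly_ring)

lemma int_poly_ring_add_closed:
  "p \<in> carrier (int_poly_ring V) \<Longrightarrow> q \<in> carrier (int_poly_ring V) \<Longrightarrow>
   p + q \<in> carrier (int_poly_ring V)"
  using Poly_Mapping.keys_add[of p q] unfolding carrier_int_poly_ring by blast

lemma int_poly_ring_uminus_closed:
  "p \<in> carrier (int_poly_ring V) \<Longrightarrow> - p \<in> carrier (int_poly_ring V)"
  by (simp add: carrier_int_poly_ring)

lemma int_poly_ring_mult_closed:
  assumes "p \<in> carrier (int_poly_ring V)" "q \<in> carrier (int_poly_ring V)"
  shows "p * q \<in> carrier (int_poly_ring V)"
proof -
  have "Poly_Mapping.keys m \<subseteq> V" if m: "m \<in> Poly_Mapping.keys (p * q)" for m
  proof -
    obtain a b where "m = a + b" "a \<in> Poly_Mapping.keys p" "b \<in> Poly_Mapping.keys q"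
      using m Poly_Mapping.keys_mult[of p q] by blast
    then show ?thesis
      using assms Poly_Mapping.keys_add[of a b] unfolding carrier_int_poly_ring by blast
  qed
  then show ?thesis by (simp add: carrier_int_poly_ring)
qed

lemma cring_int_poly_ring: "cring (int_poly_ring V)"
proof (rule cringI)
  show "abelian_group (int_poly_ring V)"
  proof (rule abelian_groupI)
    fix x assume "x \<in> carrier (int_poly_ring V)"
    then have "- x \<in> carrier (int_poly_ring V)" by (rule int_poly_ring_uminus_closed)
    then show "\<exists>y\<in>carrier (int_poly_ring V).
      y \<oplus>\<^bsub>int_poly_ring V\<^esub> x = \<zero>\<^bsub>int_poly_ring V\<^esub>"
      by (intro bexI[of _ "- x"]) (simp_all add: int_poly_ring_ops)
  qed (use int_poly_ring_add_closed int_poly_ring_zero_closed in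
        \<open>auto simp: int_poly_ring_ops algebra_simps\<close>)
  show "comm_monoid (int_poly_ring V)"
    by (rule comm_monoidI)
      (use int_poly_ring_mult_closed int_poly_ring_one_closed in
        \<open>auto simp: int_poly_ring_ops algebra_simps\<close>)
qed (auto simp: int_poly_ring_ops algebra_simps)

lemma int_poly_ring_of_nat_closed: "of_nat n \<in> carrier (int_poly_ring V)"
  by (induction n)
    (auto intro: int_poly_ring_zero_closed int_poly_ring_one_closed int_poly_ring_add_closed)

lemma gen_laplacian_closed:
  "u \<in> V \<Longrightarrow> gen_laplacian D u v \<in> carrier (int_poly_ring V)"
  by (auto simp: gen_laplacian_def int_poly_ring_of_nat_closed intro!: int_poly_ring_uminus_closed)
    (simp add: carrier_int_poly_ring indet_def)

lemma int_poly_ring_prod_closed: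
  "(\<And>x. x \<in> A \<Longrightarrow> f x \<in> carrier (int_poly_ring V)) \<Longrightarrow> prod f A \<in> carrier (int_poly_ring V)"
  by (induction A rule: infinite_finite_induct)
    (auto intro: int_poly_ring_one_closed int_poly_ring_mult_closed)

lemma int_poly_ring_sum_closed:
  "(\<And>x. x \<in> A \<Longrightarrow> f x \<in> carrier (int_poly_ring V)) \<Longrightarrow> sum f A \<in> carrier (int_poly_ring V)"
  by (induction A rule: infinite_finite_induct)
    (auto intro: int_poly_ring_zero_closed int_poly_ring_add_closed)

lemma laplacian_minors_closed: "laplacian_minors D i \<subseteq> carrier (int_poly_ring (verts D))"
proof
  fix p assume "p \<in> laplacian_minors D i"
  then obtain rs cs where p: "p = laplacian_minor D rs cs"
    and rs: "set rs \<subseteq> verts D" "length rs = i" and cs: "length cs = i"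
    unfolding laplacian_minors_def by blast
  have entry: "mat i i (\<lambda>(a, b). gen_laplacian D (rs ! a) (cs ! b)) $$ (k, \<pi> k)
      \<in> carrier (int_poly_ring (verts D))"
    if "\<pi> permutes {0..<i}" "k \<in> {0..<i}" for \<pi> k
  proof -
    have "\<pi> k < i" using that permutes_in_image[of \<pi> "{0..<i}" k] by simp
    then show ?thesis using that rs by (auto intro!: gen_laplacian_closed)
  qed
  have sgn: "signof \<pi> \<in> carrier (int_poly_ring (verts D))" for \<pi> :: "nat \<Rightarrow> nat"
    by (auto simp: sign_def int_poly_ring_one_closed intro: int_poly_ring_uminus_closed)
  show "p \<in> carrier (int_poly_ring (verts D))"
    unfolding p laplacian_minor_def Determinant.det_def using rs(2) cs
    by (auto intro!: int_poly_ring_sum_closed int_poly_ring_mult_closed sgn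
        int_poly_ring_prod_closed gen_laplacian_closed simp del: index_mat)
      (use entry in auto)
qed

end

theory Submission
  imports Defs
begin

text \<open>
  All three conditions say the same thing about the arc relation \<open>R\<close> of \<open>D\<close>: whenever \<open>u\<close> has an
  outgoing arc, \<open>v\<close> has an incoming arc and \<open>u \<noteq> v\<close>, there is an arc from \<open>u\<close> to \<open>v\<close>. In other words,
  \<open>R\<close> is the rectangle \<open>Domain R \<times> Range R\<close> without its diagonal. This property is called
  \<open>arc_exchange\<close> below.

  Algebraic co-rank (\<open>corank_le_1_iff_arc_exchange\<close>). If \<open>u \<rightarrow> a\<close> and \<open>b \<rightarrow> v\<close> are arcs while \<open>u \<rightarrow> v\<close> is
  not, then the minor with rows \<open>u, b\<close> and columns \<open>a, v\<close> is triangular with diagonal \<open>-1, -1\<close>, so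
  it equals 1; together with the entry \<open>-1\<close> at \<open>(u, a)\<close> this makes the first two critical ideals
  trivial. If the exchange property holds, substitute \<open>-1\<close> for \<open>x_u\<close> when \<open>u\<close> has both incoming and
  outgoing arcs, and \<open>0\<close> otherwise. The Laplacian becomes minus the indicator matrix of a
  rectangle, which has rank at most one. Hence all minors of size at least two vanish at this point,
  and the ideal that they generate cannot contain 1.

  Shape of \<open>D\<close> (\<open>arc_exchange_imp_iso_Lambda\<close>). In a connected digraph with the exchange property,
  let \<open>T\<close> be the sources, \<open>T'\<close> the other sinks and \<open>K\<close> the vertices with both kinds of arcs. The rectangle
  description of \<open>R\<close> is then the arc set of a \<open>\<Lambda>\<close>. Conversely the arcs of a \<open>\<Lambda>\<close> visibly form such a
  rectangle.

  Forbidden subdigraphs. The exchange property passes to induced subdigraphs and fails in each of the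
  17 forbidden digraphs, so it implies freeness. For the converse, the seven digraphs on three
  vertices are exactly the ways in which \<open>u \<rightarrow> a \<rightarrow> v\<close> can occur without \<open>u \<rightarrow> v\<close>; forbidding them makes
  \<open>R\<close> transitive off the diagonal (\<open>family_free_trans\<close>). Given transitivity, the ten digraphs on four
  vertices are exactly the ways in which disjoint arcs \<open>u \<rightarrow> a\<close> and \<open>b \<rightarrow> v\<close> that are joined by some
  further arc can violate the exchange property (\<open>family_free_crossing\<close>). Finally, connectedness
  ensures that any two disjoint arcs are joined by a further arc: by the exchange property for joined
  arcs, the set of vertices equal or adjacent to an end of a given arc is closed under adjacency.
\<close>

section \<open>The exchange property\<close>

definition arc_exchange :: "('a \<times> 'a) set \<Rightarrow> bool" where
  "arc_exchange R \<longleftrightarrow> (\<forall>u a b v. (u, a) \<in> R \<longrightarrow> (b, v) \<in> R \<longrightarrow> u \<noteq> v \<longrightarrow> (u, v) \<in> R)"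

lemma arc_exchangeD:
  "arc_exchange R \<Longrightarrow> (u, a) \<in> R \<Longrightarrow> (b, v) \<in> R \<Longrightarrow> u \<noteq> v \<Longrightarrow> (u, v) \<in> R"
  unfolding arc_exchange_def by blast

lemma arc_exchange_restrict: "arc_exchange R \<Longrightarrow> arc_exchange (R \<inter> W \<times> W)"
  unfolding arc_exchange_def by blast

lemma arc_exchange_image_iff:
  assumes inj: "inj_on f W" and R: "R \<subseteq> W \<times> W"
  shows "arc_exchange (map_prod f f ` R) \<longleftrightarrow> arc_exchange R"
proof
  assume ex: "arc_exchange (map_prod f f ` R)"
  show "arc_exchange R"
    unfolding arc_exchange_def
  proof (intro allI impI)
    fix u a b v assume ua: "(u, a) \<in> R" and bv: "(b, v) \<in> R" and uv: "u \<noteq> v"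
    have W: "u \<in> W" "v \<in> W" using R ua bv by blast+
    have "f u \<noteq> f v" using inj_onD[OF inj _ W] uv by blast
    then have "(f u, f v) \<in> map_prod f f ` R"
      by (rule arc_exchangeD[OF ex map_prod_imageI[OF ua] map_prod_imageI[OF bv]])
    then obtain x y where xy: "(x, y) \<in> R" "f x = f u" "f y = f v" by (metis prod_fun_imageE prod.inject)
    then have "x \<in> W" "y \<in> W" using R by blast+
    then have "x = u" "y = v" using xy W inj_onD[OF inj] by blast+
    with xy show "(u, v) \<in> R" by simp
  qed
next
  assume ex: "arc_exchange R"
  show "arc_exchange (map_prod f f ` R)"
    unfolding arc_exchange_def
  proof (intro allI impI)
    fix u a b v
    assume "(u, a) \<in> map_prod f f ` R" "(b, v) \<in> map_prod f f ` R" and uv: "u \<noteq> v"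
    then obtain x c d y where xc: "(x, c) \<in> R" and dy: "(d, y) \<in> R" and eq: "u = f x" "v = f y"
      by (metis prod_fun_imageE prod.inject)
    then have "x \<noteq> y" using uv by blast
    then have "(x, y) \<in> R" by (rule arc_exchangeD[OF ex xc dy])
    then show "(u, v) \<in> map_prod f f ` R" unfolding eq by (rule map_prod_imageI)
  qed
qed

section \<open>Isomorphisms and induced subdigraphs in terms of arc relations\<close>

lemma arcs_ends_arcs_digraph [simp]: "arcs_ends (arcs_digraph V A) = A"
  by (auto simp: arcs_digraph_def arcs_ends_def arc_to_ends_def)

text \<open>
  Without parallel arcs an isomorphism is determined by its vertex map, since the image of an arc is
  recovered from the images of its two ends.
\<close>
lemma digraph_iso_arcs_digraph_iff:
  assumes "digraph G"
  shows "digraph_iso G (arcs_digraph V A) \<longleftrightarrow>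
    (\<exists>f. bij_betw f (verts G) V \<and> map_prod f f ` arcs_ends G = A)"
proof
  interpret digraph G by fact
  assume "digraph_iso G (arcs_digraph V A)"
  then obtain h where h: "digraph_isomorphism h" and app: "arcs_digraph V A = app_iso h G"
    unfolding digraph_iso_def by blast
  have V: "V = iso_verts h ` verts G" and A: "A = iso_arcs h ` arcs G"
    and t: "iso_tail h = fst" and hd: "iso_head h = snd"
    using app by (auto simp: arcs_digraph_def app_iso_def)
  have "iso_arcs h e = map_prod (iso_verts h) (iso_verts h) (tail G e, head G e)" if "e \<in> arcs G" for e
    using h that t hd unfolding digraph_isomorphism_def by (auto simp: prod_eq_iff)
  then have "map_prod (iso_verts h) (iso_verts h) ` arcs_ends G = A"
    unfolding A arcs_ends_def arc_to_ends_def by (simp add: image_image)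
  moreover have "bij_betw (iso_verts h) (verts G) V"
    using h V by (simp add: bij_betw_def digraph_isomorphism_def)
  ultimately show "\<exists>f. bij_betw f (verts G) V \<and> map_prod f f ` arcs_ends G = A" by blast
next
  interpret digraph G by fact
  assume "\<exists>f. bij_betw f (verts G) V \<and> map_prod f f ` arcs_ends G = A"
  then obtain f where inj: "inj_on f (verts G)" and V: "f ` verts G = V"
    and A: "map_prod f f ` arcs_ends G = A" by (auto simp: bij_betw_def)
  define h where "h = \<lparr>iso_verts = f, iso_arcs = (\<lambda>e. (f (tail G e), f (head G e))),
    iso_head = snd, iso_tail = fst\<rparr>"
  have "inj_on (iso_arcs h) (arcs G)"
  proof (rule inj_onI)
    fix e e' assume e: "e \<in> arcs G" "e' \<in> arcs G" and eq: "iso_arcs h e = iso_arcs h e'"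
    then have "arc_to_ends G e = arc_to_ends G e'"
      using inj by (auto simp: h_def arc_to_ends_def inj_on_eq_iff)
    with e show "e = e'" by (rule no_multi_arcs)
  qed
  then have "digraph_isomorphism h"
    using inj wf_digraph_axioms by (simp add: digraph_isomorphism_def h_def)
  moreover have "arcs_digraph V A = app_iso h G"
    using V A by (auto simp: arcs_digraph_def app_iso_def h_def arcs_ends_def arc_to_ends_def image_image)
  ultimately show "digraph_iso G (arcs_digraph V A)"
    unfolding digraph_iso_def by blast
qed

lemma arcs_ends_induced:
  "induced_subgraph H D \<Longrightarrow> arcs_ends H = arcs_ends D \<inter> verts H \<times> verts H"
  by (auto simp: induced_subgraph_def subgraph_def compatible_def arcs_ends_def arc_to_ends_def)

lemma digraph_induced_subgraph:
  assumes "digraph D" "induced_subgraph H D"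
  shows "digraph H"
proof -
  interpret digraph D by fact
  have sub: "subgraph H D" using assms(2) by (simp add: induced_subgraph_def)
  then have wf: "wf_digraph H" and comp: "tail H = tail D" "head H = head D"
    and sub': "verts H \<subseteq> verts D" "arcs H \<subseteq> arcs D"
    by (auto simp: subgraph_def compatible_def)
  interpret H: wf_digraph H by fact
  show ?thesis
  proof unfold_locales
    show "finite (verts H)" "finite (arcs H)" using sub' finite_verts finite_arcs finite_subset by blast+
  next
    fix e assume "e \<in> arcs H"
    then show "tail H e \<noteq> head H e" using sub' no_loops by (auto simp: comp)
  next
    fix e e' assume "e \<in> arcs H" "e' \<in> arcs H" "arc_to_ends H e = arc_to_ends H e'"
    then show "e = e'" using sub' by (intro no_multi_arcs) (auto simp: arc_to_ends_def comp)
  qed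
qed

section \<open>The forbidden family\<close>

lemma arc_exchange_imp_family_free:
  assumes D: "digraph D" and ex: "arc_exchange (arcs_ends D)"
    and bad: "\<And>F. F \<in> \<F> \<Longrightarrow> \<exists>V A. F = arcs_digraph V A \<and> \<not> arc_exchange A"
  shows "family_free \<F> D"
  unfolding family_free_def
proof (safe)
  fix H F assume H: "induced_subgraph H D" "digraph_iso H F" and "F \<in> \<F>"
  then obtain V A where F: "F = arcs_digraph V A" and A: "\<not> arc_exchange A"
    using bad by blast
  have dH: "digraph H" by (rule digraph_induced_subgraph) fact+
  obtain f where f: "inj_on f (verts H)" "map_prod f f ` arcs_ends H = A"
    using H(2) unfolding F digraph_iso_arcs_digraph_iff[OF dH] by (auto simp: bij_betw_def)
  have "arc_exchange (arcs_ends H)"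
    unfolding arcs_ends_induced[OF H(1)] using ex by (rule arc_exchange_restrict)
  moreover have "arcs_ends H \<subseteq> verts H \<times> verts H"
    unfolding arcs_ends_induced[OF H(1)] by (rule Int_lower2)
  ultimately have "arc_exchange A"
    using arc_exchange_image_iff[OF f(1)] f(2) by metis
  with A show False by blast
qed

lemma forbidden_family_not_exchange:
  assumes "F \<in> forbidden_family"
  shows "\<exists>V A. F = arcs_digraph V A \<and> \<not> arc_exchange A"
proof -
  \<comment> \<open>With quantifiers bounded by the finite arc set, the violation is found by rewriting.\<close>
  define viol :: "(nat \<times> nat) set \<Rightarrow> bool" where
    "viol A \<longleftrightarrow> (\<exists>e \<in> A. \<exists>e' \<in> A. fst e \<noteq> snd e' \<and> (fst e, snd e') \<notin> A)" for A
  have "viol A \<Longrightarrow> \<not> arc_exchange A" for A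
    unfolding viol_def arc_exchange_def by (metis prod.collapse)
  moreover have "\<forall>F \<in> forbidden_family. \<exists>V A. F = arcs_digraph V A \<and> viol A"
    unfolding forbidden_family_def ball_simps
    by (intro conjI TrueI; rule exI, rule exI, rule conjI, rule refl, simp add: viol_def)
  ultimately show ?thesis using assms by blast
qed

lemma family_freeD:
  assumes free: "family_free \<F> D" and D: "digraph D" and mem: "arcs_digraph V A \<in> \<F>"
    and A: "A \<subseteq> V \<times> V" and g: "inj_on g V" "g ` V \<subseteq> verts D"
    and arcs: "\<forall>i \<in> V. \<forall>j \<in> V. (g i, g j) \<in> arcs_ends D \<longleftrightarrow> (i, j) \<in> A"
  shows False
proof -
  interpret digraph D by fact
  let ?H = "D \<restriction> (g ` V)" and ?f = "the_inv_into V g"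
  have H: "induced_subgraph ?H D" using g(2) by (rule induced_induce)
  have inv: "?f (g i) = i" if "i \<in> V" for i using g(1) that by (rule the_inv_into_f_f)
  have "arcs_ends ?H = map_prod g g ` A"
  proof -
    have "(x, y) \<in> map_prod g g ` A \<longleftrightarrow> (x, y) \<in> arcs_ends D \<inter> (g ` V) \<times> (g ` V)" for x y
    proof
      assume "(x, y) \<in> map_prod g g ` A"
      then show "(x, y) \<in> arcs_ends D \<inter> (g ` V) \<times> (g ` V)" using A arcs by auto
    next
      assume "(x, y) \<in> arcs_ends D \<inter> (g ` V) \<times> (g ` V)"
      then obtain i j where "i \<in> V" "j \<in> V" "x = g i" "y = g j" "(i, j) \<in> A" using arcs by auto
      then show "(x, y) \<in> map_prod g g ` A" by (auto intro: rev_image_eqI)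
    qed
    then show ?thesis unfolding arcs_ends_induced[OF H] induce_subgraph_verts set_eq_iff split_paired_All by blast
  qed
  then have "map_prod ?f ?f ` arcs_ends ?H = (\<lambda>p. map_prod ?f ?f (map_prod g g p)) ` A"
    by (simp add: image_image)
  also have "\<dots> = (\<lambda>p. p) ` A"
    using A by (intro image_cong) (auto simp: inv)
  finally have "map_prod ?f ?f ` arcs_ends ?H = A" by simp
  moreover have "bij_betw ?f (verts ?H) V"
    using bij_betw_the_inv_into[of g V "g ` V"] g(1) by (simp add: bij_betw_def)
  ultimately have "digraph_iso ?H (arcs_digraph V A)"
    unfolding digraph_iso_arcs_digraph_iff[OF digraph_induced_subgraph[OF D H]] by auto
  with free H mem show False unfolding family_free_def by blast
qed

text \<open>
  A placement of the vertices 1 to 3 (and below 1 to 4) is given as a list, so that the comparison of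
  arcs becomes a finite conjunction about named vertices.
\<close>
lemma no_forbidden_on_3:
  assumes free: "family_free forbidden_family D" and D: "digraph D"
    and dist: "distinct [p, q, r]" and V: "{p, q, r} \<subseteq> verts D"
    and mem: "arcs_digraph {1..3} A \<in> forbidden_family" and A: "A \<subseteq> {1..3} \<times> {1..3}"
    and arcs: "\<forall>i \<in> {1, 2, 3}. \<forall>j \<in> {1, 2, 3}.
      ([p, q, r] ! (i - 1), [p, q, r] ! (j - 1)) \<in> arcs_ends D \<longleftrightarrow> (i, j) \<in> A"
  shows False
proof (rule family_freeD[OF free D mem A])
  have iv: "{1..3} = {1, 2, 3 :: nat}" by auto
  let ?g = "\<lambda>i. [p, q, r] ! (i - 1)"
  show "inj_on ?g {1..3}" using dist unfolding iv by (auto simp: inj_on_def)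
  show "?g ` {1..3} \<subseteq> verts D" using V unfolding iv by simp
  show "\<forall>i \<in> {1..3}. \<forall>j \<in> {1..3}. (?g i, ?g j) \<in> arcs_ends D \<longleftrightarrow> (i, j) \<in> A"
    using arcs unfolding iv .
qed

lemma no_forbidden_on_4:
  assumes free: "family_free forbidden_family D" and D: "digraph D"
    and dist: "distinct [p, q, r, s]" and V: "{p, q, r, s} \<subseteq> verts D"
    and mem: "arcs_digraph {1..4} A \<in> forbidden_family" and A: "A \<subseteq> {1..4} \<times> {1..4}"
    and arcs: "\<forall>i \<in> {1, 2, 3, 4}. \<forall>j \<in> {1, 2, 3, 4}.
      ([p, q, r, s] ! (i - 1), [p, q, r, s] ! (j - 1)) \<in> arcs_ends D \<longleftrightarrow> (i, j) \<in> A"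
  shows False
proof (rule family_freeD[OF free D mem A])
  have iv: "{1..4} = {1, 2, 3, 4 :: nat}" by auto
  let ?g = "\<lambda>i. [p, q, r, s] ! (i - 1)"
  show "inj_on ?g {1..4}" using dist unfolding iv by (auto simp: inj_on_def)
  show "?g ` {1..4} \<subseteq> verts D" using V unfolding iv by simp
  show "\<forall>i \<in> {1..4}. \<forall>j \<in> {1..4}. (?g i, ?g j) \<in> arcs_ends D \<longleftrightarrow> (i, j) \<in> A"
    using arcs unfolding iv .
qed

context digraph
begin

lemma no_loop_arcs_ends: "(u, u) \<notin> arcs_ends G"
  using no_loops by (auto simp: arcs_ends_def arc_to_ends_def)

text \<open>
  With \<open>u \<rightarrow> a \<rightarrow> v\<close> present and \<open>u \<rightarrow> v\<close> absent, three arcs \<open>a \<rightarrow> u\<close>, \<open>v \<rightarrow> a\<close>, \<open>v \<rightarrow> u\<close> remain undecided.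
  The eight possibilities give the seven forbidden digraphs on three vertices, one of them twice.
\<close>
lemma family_free_trans:
  assumes free: "family_free forbidden_family G"
    and ua: "(u, a) \<in> arcs_ends G" and av: "(a, v) \<in> arcs_ends G" and uv: "u \<noteq> v"
  shows "(u, v) \<in> arcs_ends G"
proof (rule ccontr)
  let ?R = "arcs_ends G"
  assume nuv: "(u, v) \<notin> ?R"
  note no_loop_arcs_ends [simp]
  have neq: "u \<noteq> a" "a \<noteq> v" using ua av by auto
  have V: "u \<in> verts G" "a \<in> verts G" "v \<in> verts G" using ua av by auto
  note no3 = no_forbidden_on_3[OF free digraph_axioms]
  note facts = neq uv V ua av nuv
  consider
      "(a, u) \<notin> ?R" "(v, a) \<notin> ?R" "(v, u) \<notin> ?R"
    | "(a, u) \<in> ?R" "(v, a) \<notin> ?R" "(v, u) \<notin> ?R"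
    | "(a, u) \<notin> ?R" "(v, a) \<in> ?R" "(v, u) \<notin> ?R"
    | "(a, u) \<in> ?R" "(v, a) \<in> ?R" "(v, u) \<notin> ?R"
    | "(a, u) \<notin> ?R" "(v, a) \<notin> ?R" "(v, u) \<in> ?R"
    | "(a, u) \<in> ?R" "(v, a) \<notin> ?R" "(v, u) \<in> ?R"
    | "(a, u) \<notin> ?R" "(v, a) \<in> ?R" "(v, u) \<in> ?R"
    | "(a, u) \<in> ?R" "(v, a) \<in> ?R" "(v, u) \<in> ?R"
    by blast
  then show False
  proof cases
    case 1
    show False
      by (rule no3[of u v a "{(1,3), (3,2)}"]) (use facts 1 in \<open>auto simp: forbidden_family_def\<close>)
  next
    case 2
    show False
      by (rule no3[of u v a "{(1,3), (3,1), (3,2)}"]) (use facts 2 in \<open>auto simp: forbidden_family_def\<close>)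
  next
    case 3
    show False
      by (rule no3[of v u a "{(1,3), (3,1), (2,3)}"]) (use facts 3 in \<open>auto simp: forbidden_family_def\<close>)
  next
    case 4
    show False
      by (rule no3[of u v a "{(1,3), (3,1), (2,3), (3,2)}"])
        (use facts 4 in \<open>auto simp: forbidden_family_def\<close>)
  next
    case 5
    show False
      by (rule no3[of u a v "{(1,2), (2,3), (3,1)}"]) (use facts 5 in \<open>auto simp: forbidden_family_def\<close>)
  next
    case 6
    show False
      by (rule no3[of a u v "{(1,2), (2,1), (1,3), (3,2)}"])
        (use facts 6 in \<open>auto simp: forbidden_family_def\<close>)
  next
    case 7
    show False
      by (rule no3[of v a u "{(1,2), (2,1), (1,3), (3,2)}"])
        (use facts 7 in \<open>auto simp: forbidden_family_def\<close>)
  next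
    case 8
    show False
      by (rule no3[of a v u "{(1,2), (2,1), (1,3), (3,1), (2,3)}"])
        (use facts 8 in \<open>auto simp: forbidden_family_def\<close>)
  qed
qed

text \<open>
  If \<open>u \<rightarrow> v\<close> is absent, transitivity excludes \<open>a \<rightarrow> b\<close>, \<open>a \<rightarrow> v\<close> and \<open>u \<rightarrow> b\<close>, and every other connecting
  arc forces \<open>b \<rightarrow> a\<close>. What remains are the arcs \<open>b \<rightarrow> u\<close>, \<open>v \<rightarrow> a\<close>, \<open>v \<rightarrow> u\<close>, \<open>a \<rightarrow> u\<close> and \<open>v \<rightarrow> b\<close>;
  transitivity leaves ten combinations of them, one for each forbidden digraph on four vertices.
\<close>
lemma family_free_crossing:
  assumes free: "family_free forbidden_family G"
    and ua: "(u, a) \<in> arcs_ends G" and bv: "(b, v) \<in> arcs_ends G" and uv: "u \<noteq> v"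
    and cross: "\<exists>x \<in> {u, a}. \<exists>y \<in> {b, v}. (x, y) \<in> arcs_ends G \<or> (y, x) \<in> arcs_ends G"
  shows "(u, v) \<in> arcs_ends G"
proof (rule ccontr)
  let ?R = "arcs_ends G"
  assume nuv: "(u, v) \<notin> ?R"
  note no_loop_arcs_ends [simp]
  note trans = family_free_trans[OF free]
  have neq: "u \<noteq> a" "b \<noteq> v" "a \<noteq> v" "b \<noteq> u" using ua bv nuv by auto
  have ab: "a \<noteq> b" using trans[OF ua, of v] bv uv nuv by auto
  have nav: "(a, v) \<notin> ?R" using trans[OF ua, of v] uv nuv by blast
  have nub: "(u, b) \<notin> ?R" using trans[OF _ bv, of u] uv nuv by blast
  have nab: "(a, b) \<notin> ?R" using trans[OF ua, of b] neq nub by blast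
  have V: "u \<in> verts G" "a \<in> verts G" "b \<in> verts G" "v \<in> verts G" using ua bv by auto
  have au_bu: "(b, a) \<in> ?R \<Longrightarrow> (a, u) \<in> ?R \<Longrightarrow> (b, u) \<in> ?R" using trans[of b a u] neq by blast
  have bu_ba: "(b, u) \<in> ?R \<Longrightarrow> (b, a) \<in> ?R" using trans[of b u a] ua ab by blast
  have va_ba: "(v, a) \<in> ?R \<Longrightarrow> (b, a) \<in> ?R" using trans[OF bv, of a] ab by blast
  have vu_bu: "(v, u) \<in> ?R \<Longrightarrow> (b, u) \<in> ?R" using trans[OF bv, of u] neq by blast
  have vu_va: "(v, u) \<in> ?R \<Longrightarrow> (v, a) \<in> ?R" using trans[OF _ ua, of v] neq by blast
  have ba: "(b, a) \<in> ?R" using cross nuv nav nub nab bu_ba va_ba vu_bu by blast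
  have vb_va: "(v, b) \<in> ?R \<Longrightarrow> (v, a) \<in> ?R" using trans[OF _ ba, of v] neq by blast
  have va_au_vu: "(v, a) \<in> ?R \<Longrightarrow> (a, u) \<in> ?R \<Longrightarrow> (v, u) \<in> ?R" using trans[of v a u] uv by blast
  have vb_bu_vu: "(v, b) \<in> ?R \<Longrightarrow> (b, u) \<in> ?R \<Longrightarrow> (v, u) \<in> ?R" using trans[of v b u] uv by blast
  note no4 = no_forbidden_on_4[OF free digraph_axioms]
  note facts = neq ab uv V ua bv ba nuv nav nub nab
  show False
  proof (cases "(v, u) \<in> ?R")
    case vu: True
    note vu = vu vu_bu[OF vu] vu_va[OF vu]
    show ?thesis
    proof (cases "(a, u) \<in> ?R"; cases "(v, b) \<in> ?R")
      assume au: "(a, u) \<in> ?R" and vb: "(v, b) \<in> ?R"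
      show ?thesis
        by (rule no4[of b v u a "{(1,2), (2,1), (1,3), (1,4), (2,3), (2,4), (3,4), (4,3)}"])
          (use facts vu au vb in \<open>auto simp: forbidden_family_def\<close>)
    next
      assume au: "(a, u) \<in> ?R" and vb: "(v, b) \<notin> ?R"
      show ?thesis
        by (rule no4[of u a b v "{(1,2), (2,1), (3,1), (3,2), (3,4), (4,1), (4,2)}"])
          (use facts vu au vb in \<open>auto simp: forbidden_family_def\<close>)
    next
      assume au: "(a, u) \<notin> ?R" and vb: "(v, b) \<in> ?R"
      show ?thesis
        by (rule no4[of b v u a "{(1,2), (2,1), (1,3), (1,4), (2,3), (2,4), (3,4)}"])
          (use facts vu au vb in \<open>auto simp: forbidden_family_def\<close>)
    next
      assume au: "(a, u) \<notin> ?R" and vb: "(v, b) \<notin> ?R"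
      show ?thesis
        by (rule no4[of b v u a "{(1,2), (1,3), (1,4), (2,3), (2,4), (3,4)}"])
          (use facts vu au vb in \<open>auto simp: forbidden_family_def\<close>)
    qed
  next
    case nvu: False
    show ?thesis
    proof (cases "(v, a) \<in> ?R")
      case va: True
      with nvu va_au_vu have nau: "(a, u) \<notin> ?R" by blast
      consider "(v, b) \<in> ?R" "(b, u) \<notin> ?R" | "(v, b) \<notin> ?R" "(b, u) \<in> ?R"
        | "(v, b) \<notin> ?R" "(b, u) \<notin> ?R"
        using nvu vb_bu_vu by blast
      then show ?thesis
      proof cases
        case 1
        show ?thesis
          by (rule no4[of b u v a "{(1,3), (3,1), (1,4), (2,4), (3,4)}"])
            (use facts nvu va nau 1 in \<open>auto simp: forbidden_family_def\<close>)
      next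
        case 2
        show ?thesis
          by (rule no4[of u v a b "{(1,3), (2,3), (4,1), (4,2), (4,3)}"])
            (use facts nvu va nau 2 in \<open>auto simp: forbidden_family_def\<close>)
      next
        case 3
        show ?thesis
          by (rule no4[of b u v a "{(1,3), (1,4), (2,4), (3,4)}"])
            (use facts nvu va nau 3 in \<open>auto simp: forbidden_family_def\<close>)
      qed
    next
      case nva: False
      with vb_va have nvb: "(v, b) \<notin> ?R" by blast
      consider "(b, u) \<in> ?R" "(a, u) \<in> ?R" | "(b, u) \<in> ?R" "(a, u) \<notin> ?R"
        | "(b, u) \<notin> ?R" "(a, u) \<notin> ?R"
        using au_bu[OF ba] by blast
      then show ?thesis
      proof cases
        case 1
        show ?thesis
          by (rule no4[of u v a b "{(1,3), (3,1), (4,1), (4,2), (4,3)}"])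
            (use facts nvu nva nvb 1 in \<open>auto simp: forbidden_family_def\<close>)
      next
        case 2
        show ?thesis
          by (rule no4[of u v a b "{(1,3), (4,1), (4,2), (4,3)}"])
            (use facts nvu nva nvb 2 in \<open>auto simp: forbidden_family_def\<close>)
      next
        case 3
        show ?thesis
          by (rule no4[of b u v a "{(1,3), (1,4), (2,4)}"])
            (use facts nvu nva nvb 3 in \<open>auto simp: forbidden_family_def\<close>)
      qed
    qed
  qed
qed

lemma connected_adjacency_closed:
  assumes conn: "Digraph_Component.connected G" and u: "u \<in> S" "u \<in> verts G"
    and closed: "\<And>x y. x \<in> S \<Longrightarrow> (x, y) \<in> arcs_ends G \<or> (y, x) \<in> arcs_ends G \<Longrightarrow> y \<in> S"
  shows "verts G \<subseteq> S"
proof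
  fix v assume "v \<in> verts G"
  then have "u \<rightarrow>\<^sup>*\<^bsub>mk_symmetric G\<^esub> v"
    using conn u by (auto simp: connected_def strongly_connected_def)
  then have "(u, v) \<in> rtrancl_on (verts G) (parcs (mk_symmetric G))"
    by (simp add: reachable_def)
  then show "v \<in> S"
  proof (induction rule: rtrancl_on_induct)
    case base
    then show ?case using u by simp
  next
    case (step x y)
    have "(x, y) \<in> arcs_ends G \<or> (y, x) \<in> arcs_ends G"
      using step.hyps by (auto simp: parcs_mk_symmetric arcs_ends_def arc_to_ends_def)
    with step.IH closed show ?case by blast
  qed
qed

text \<open>
  By connectedness every vertex is an end of the arc \<open>u \<rightarrow> a\<close> or adjacent to one, so every arc
  disjoint from it is joined to it.
\<close>
lemma family_free_imp_arc_exchange: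
  assumes conn: "Digraph_Component.connected G" and free: "family_free forbidden_family G"
  shows "arc_exchange (arcs_ends G)"
  unfolding arc_exchange_def
proof (intro allI impI)
  let ?R = "arcs_ends G"
  fix u a b v assume ua: "(u, a) \<in> ?R" and bv: "(b, v) \<in> ?R" and uv: "u \<noteq> v"
  let ?adj = "\<lambda>x y. (x, y) \<in> ?R \<or> (y, x) \<in> ?R"
  let ?S = "{w. w \<in> {u, a} \<or> ?adj w u \<or> ?adj w a}"
  have "verts G \<subseteq> ?S"
  proof (rule connected_adjacency_closed[OF conn, of u])
    fix x y assume x: "x \<in> ?S" and xy: "?adj x y"
    show "y \<in> ?S"
    proof (cases "x \<in> {u, a} \<or> y \<in> {u, a}")
      case False
      then have "?adj x u \<or> ?adj x a" using x by blast
      \<comment> \<open>An arc between \<open>x\<close> and \<open>y\<close> is joined to \<open>u \<rightarrow> a\<close> at \<open>x\<close>; exchange attaches \<open>y\<close> as well, by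
        \<open>u \<rightarrow> y\<close> or \<open>y \<rightarrow> a\<close> depending on its direction.\<close>
      with False xy show ?thesis
        using family_free_crossing[OF free ua, of x y] family_free_crossing[OF free _ ua, of y x]
        by blast
    qed (use xy in blast)
  qed (use ua in auto)
  moreover have "b \<in> verts G" using bv by auto
  ultimately have "b \<in> ?S" by blast
  show "(u, v) \<in> ?R"
  proof (cases "b \<in> {u, a}")
    case True
    then show ?thesis using bv family_free_trans[OF free ua _ uv] by blast
  next
    case False
    with \<open>b \<in> ?S\<close> show ?thesis using family_free_crossing[OF free ua bv uv] by blast
  qed
qed

end

section \<open>The digraphs \<open>\<Lambda>\<close>\<close>

text \<open>
  The four kinds of arcs of a \<open>\<Lambda>\<close> merge into one off-diagonal rectangle when the parts are disjoint.
\<close>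
definition Lambda_arcs :: "'a set \<Rightarrow> 'a set \<Rightarrow> 'a set \<Rightarrow> ('a \<times> 'a) set" where
  "Lambda_arcs T K T' = {(u, v). u \<noteq> v \<and> u \<in> T \<union> K \<and> v \<in> K \<union> T'}"

lemma arc_exchange_Lambda_arcs: "arc_exchange (Lambda_arcs T K T')"
  by (auto simp: arc_exchange_def Lambda_arcs_def)

lemma Lambda_eq_arcs_digraph:
  "Lambda n1 n2 n3 = arcs_digraph ({..<n1} \<union> {n1..<n1 + n2} \<union> {n1 + n2..<n1 + n2 + n3})
    (Lambda_arcs {..<n1} {n1..<n1 + n2} {n1 + n2..<n1 + n2 + n3})"
  unfolding Lambda_def Let_def Lambda_arcs_def
  by (rule arg_cong2[where f = arcs_digraph]) auto

lemma map_prod_Lambda_arcs: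
  assumes "inj_on f (T \<union> K \<union> T')"
  shows "map_prod f f ` Lambda_arcs T K T' = Lambda_arcs (f ` T) (f ` K) (f ` T')"
proof -
  have neq: "f x \<noteq> f y" if "x \<in> T \<union> K" "y \<in> K \<union> T'" "x \<noteq> y" for x y
    using that inj_onD[OF assms, of x y] by blast
  show ?thesis
  proof (intro equalityI subrelI)
    fix a b assume "(a, b) \<in> map_prod f f ` Lambda_arcs T K T'"
    then show "(a, b) \<in> Lambda_arcs (f ` T) (f ` K) (f ` T')"
      using neq unfolding Lambda_arcs_def by blast
  next
    fix a b assume "(a, b) \<in> Lambda_arcs (f ` T) (f ` K) (f ` T')"
    then obtain x y where "x \<in> T \<union> K" "y \<in> K \<union> T'" "a = f x" "b = f y" "a \<noteq> b"
      unfolding Lambda_arcs_def by blast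
    then have "(a, b) = map_prod f f (x, y)" "(x, y) \<in> Lambda_arcs T K T'"
      by (auto simp: Lambda_arcs_def)
    then show "(a, b) \<in> map_prod f f ` Lambda_arcs T K T'" by (rule image_eqI)
  qed
qed

lemma (in digraph) iso_Lambda_imp_arc_exchange:
  assumes "digraph_iso G (Lambda n1 n2 n3)"
  shows "arc_exchange (arcs_ends G)"
proof -
  obtain f :: "'a \<Rightarrow> nat" and T K T'
    where "inj_on f (verts G)" "map_prod f f ` arcs_ends G = Lambda_arcs T K T'"
    using assms unfolding Lambda_eq_arcs_digraph digraph_iso_arcs_digraph_iff[OF digraph_axioms]
      bij_betw_def by blast
  moreover from this have "arc_exchange (map_prod f f ` arcs_ends G)"
    by (simp add: arc_exchange_Lambda_arcs)
  moreover have "arcs_ends G \<subseteq> verts G \<times> verts G" by auto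
  ultimately show ?thesis
    using arc_exchange_image_iff[of f "verts G" "arcs_ends G"] by blast
qed

lemma (in digraph) iso_LambdaI:
  assumes V: "verts G = T \<union> K \<union> T'" and disj: "T \<inter> K = {}" "(T \<union> K) \<inter> T' = {}"
    and R: "arcs_ends G = Lambda_arcs T K T'"
  shows "digraph_iso G (Lambda (card T) (card K) (card T'))"
proof -
  let ?n1 = "card T" and ?n2 = "card K" and ?n3 = "card T'"
  let ?N1 = "{..<?n1}" and ?N2 = "{?n1..<?n1 + ?n2}" and ?N3 = "{?n1 + ?n2..<?n1 + ?n2 + ?n3}"
  have fin: "finite T" "finite K" "finite T'" using V finite_verts by auto
  obtain f1 where f1: "bij_betw f1 T ?N1"
    using fin finite_same_card_bij[of T ?N1] by auto
  obtain f2 where f2: "bij_betw f2 K ?N2"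
    using fin finite_same_card_bij[of K ?N2] by auto
  obtain f3 where f3: "bij_betw f3 T' ?N3"
    using fin finite_same_card_bij[of T' ?N3] by auto
  define f where "f = (\<lambda>x. if x \<in> T \<union> K then (if x \<in> T then f1 x else f2 x) else f3 x)"
  have bij: "bij_betw f (T \<union> K \<union> T') (?N1 \<union> ?N2 \<union> ?N3)"
    unfolding f_def by (intro bij_betw_disjoint_Un f1 f2 f3 disj) auto
  have "f ` T = f1 ` T" "f ` K = f2 ` K" "f ` T' = f3 ` T'"
    using disj by (auto simp: f_def intro!: image_cong)
  then have im: "f ` T = ?N1" "f ` K = ?N2" "f ` T' = ?N3"
    using f1 f2 f3 by (simp_all add: bij_betw_def)
  have "map_prod f f ` arcs_ends G = Lambda_arcs ?N1 ?N2 ?N3"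
    unfolding R using bij map_prod_Lambda_arcs[of f T K T'] im by (simp add: bij_betw_def)
  with bij show ?thesis
    unfolding Lambda_eq_arcs_digraph digraph_iso_arcs_digraph_iff[OF digraph_axioms] V by blast
qed

lemma (in digraph) arc_exchange_imp_iso_Lambda:
  assumes conn: "Digraph_Component.connected G" and ex: "arc_exchange (arcs_ends G)"
  shows "\<exists>n1 n2 n3. digraph_iso G (Lambda n1 n2 n3)"
proof -
  let ?R = "arcs_ends G"
  define T where "T = {v \<in> verts G. v \<notin> Range ?R}"
  define K where "K = {v \<in> verts G. v \<in> Range ?R \<and> v \<in> Domain ?R}"
  define T' where "T' = {v \<in> verts G. v \<in> Range ?R \<and> v \<notin> Domain ?R}"
  \<comment> \<open>A vertex without any arc lies in \<open>T\<close> but is not the tail of an arc; connectedness leaves it only in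
    the digraph with one vertex.\<close>
  have isolated: "w = u" if "u \<in> verts G" "w \<in> verts G" "u \<notin> Range ?R" "u \<notin> Domain ?R" for u w
    using connected_adjacency_closed[OF conn, of u "{u}"] that by auto
  have "?R = Lambda_arcs T K T'"
  proof (intro equalityI subrelI)
    fix u v assume uv: "(u, v) \<in> ?R"
    then have "u \<noteq> v" "u \<in> verts G" "v \<in> verts G" using no_loop_arcs_ends by auto
    with uv show "(u, v) \<in> Lambda_arcs T K T'" by (auto simp: Lambda_arcs_def T_def K_def T'_def)
  next
    fix u v assume "(u, v) \<in> Lambda_arcs T K T'"
    then have uv: "u \<noteq> v" "u \<in> T \<union> K" "v \<in> Range ?R" "v \<in> verts G"
      by (auto simp: Lambda_arcs_def K_def T'_def)
    then have "u \<in> Domain ?R" using isolated[of u v] by (auto simp: T_def K_def)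
    with uv show "(u, v) \<in> ?R" using arc_exchangeD[OF ex] by blast
  qed
  then have "digraph_iso G (Lambda (card T) (card K) (card T'))"
    by (intro iso_LambdaI) (auto simp: T_def K_def T'_def)
  then show ?thesis by blast
qed

section \<open>Evaluation of integer polynomials\<close>

definition monom_eval :: "('a \<Rightarrow> int) \<Rightarrow> ('a \<Rightarrow>\<^sub>0 nat) \<Rightarrow> int" where
  "monom_eval x m = Prod_any (\<lambda>u. x u ^ Poly_Mapping.lookup m u)"

definition poly_eval :: "('a \<Rightarrow> int) \<Rightarrow> 'a int_mpoly \<Rightarrow> int" where
  "poly_eval x p = (\<Sum>m \<in> Poly_Mapping.keys p. Poly_Mapping.lookup p m * monom_eval x m)"

lemma monom_eval_add: "monom_eval x (m + m') = monom_eval x m * monom_eval x m'"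
proof -
  have "finite {u. x u ^ Poly_Mapping.lookup k u \<noteq> 1}" for k
    by (rule finite_subset[OF _ finite_keys[of k]]) (auto simp: in_keys_iff intro: ccontr)
  then show ?thesis
    by (simp add: monom_eval_def lookup_add power_add Prod_any.distrib)
qed

lemma poly_eval_single: "poly_eval x (Poly_Mapping.single m c) = c * monom_eval x m"
  by (simp add: poly_eval_def)

lemma poly_eval_add: "poly_eval x (p + q) = poly_eval x p + poly_eval x q"
  unfolding poly_eval_def
  by (rule setsum_keys_plus_distrib[of "\<lambda>m c. c * monom_eval x m"]) (simp_all add: algebra_simps)

lemma poly_eval_diff: "poly_eval x (p - q) = poly_eval x p - poly_eval x q"
  using poly_eval_add[of x "p - q" q] by simp

lemma poly_eval_mult: "poly_eval x (p * q) = poly_eval x p * poly_eval x q"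
proof (induction p rule: frag_induction[OF subset_UNIV, case_names zero one diff])
  case zero
  show ?case by (simp add: poly_eval_def)
next
  case (one m)
  show ?case
  proof (induction q rule: frag_induction[OF subset_UNIV, case_names zero one diff])
    case zero
    show ?case by (simp add: poly_eval_def)
  next
    case (one m')
    show ?case by (simp add: mult_single poly_eval_single monom_eval_add)
  next
    case (diff q q')
    then show ?case by (simp add: right_diff_distrib poly_eval_diff)
  qed
next
  case (diff p p')
  then show ?case by (simp add: left_diff_distrib poly_eval_diff)
qed

lemma poly_eval_0: "poly_eval x 0 = 0"
  by (simp add: poly_eval_def)

lemma poly_eval_1: "poly_eval x 1 = 1"
  using poly_eval_single[of x 0 1] by (simp add: monom_eval_def)

interpretation poly_eval: comm_ring_hom "poly_eval x"
  by unfold_locales (simp_all add: poly_eval_0 poly_eval_1 poly_eval_add poly_eval_mult)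

lemma poly_eval_indet: "poly_eval x (indet u) = x u"
proof -
  have "monom_eval x (Poly_Mapping.single u 1) = Prod_any (\<lambda>w. if w = u then x u else 1)"
    unfolding monom_eval_def by (intro arg_cong[where f = Prod_any]) (auto simp: lookup_single when_def)
  then show ?thesis by (simp add: indet_def poly_eval_single)
qed

lemma ideal_poly_eval_zero: "ideal {p \<in> carrier (int_poly_ring V). poly_eval x p = 0} (int_poly_ring V)"
proof -
  interpret P: cring "int_poly_ring V" by (rule cring_int_poly_ring)
  have inv: "\<ominus>\<^bsub>int_poly_ring V\<^esub> p = - p" if "p \<in> carrier (int_poly_ring V)" for p
    using that int_poly_ring_uminus_closed[OF that]
    by (intro P.minus_equality) (simp_all add: int_poly_ring_ops)
  show ?thesis
  proof (rule idealI)
    show "subgroup {p \<in> carrier (int_poly_ring V). poly_eval x p = 0} (add_monoid (int_poly_ring V))"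
      by (rule P.add.subgroupI)
        (auto simp: inv int_poly_ring_ops poly_eval.hom_uminus poly_eval.hom_add simp flip: a_inv_def
          intro: int_poly_ring_uminus_closed int_poly_ring_add_closed int_poly_ring_zero_closed)
  qed (auto simp: int_poly_ring_ops poly_eval.hom_mult intro: int_poly_ring_mult_closed
      simp: P.ring_axioms)
qed

section \<open>Trivial critical ideals\<close>

lemma trivial_critical_idealI:
  assumes p: "p \<in> laplacian_minors D i" and unit: "p * p = 1"
  shows "trivial_critical_ideal D i"
proof -
  interpret P: cring "int_poly_ring (verts D)" by (rule cring_int_poly_ring)
  interpret I: ideal "critical_ideal D i" "int_poly_ring (verts D)"
    unfolding critical_ideal_def by (rule P.genideal_ideal[OF laplacian_minors_closed])
  have "p \<in> critical_ideal D i"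
    unfolding critical_ideal_def using P.genideal_self[OF laplacian_minors_closed] p by blast
  moreover have "p \<in> carrier (int_poly_ring (verts D))" using p laplacian_minors_closed by blast
  ultimately have "\<one>\<^bsub>int_poly_ring (verts D)\<^esub> \<in> critical_ideal D i"
    using I.I_l_closed[of p p] unit by (simp add: int_poly_ring_ops)
  then show ?thesis
    unfolding trivial_critical_ideal_def P.genideal_one by (rule I.one_imp_carrier)
qed

text \<open>The polynomials vanishing at a common zero of the minors form an ideal without 1.\<close>
lemma not_trivial_critical_idealI:
  assumes "\<And>p. p \<in> laplacian_minors D i \<Longrightarrow> poly_eval x p = 0"
  shows "\<not> trivial_critical_ideal D i"
proof
  interpret P: cring "int_poly_ring (verts D)" by (rule cring_int_poly_ring)
  assume "trivial_critical_ideal D i"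
  then have "1 \<in> critical_ideal D i"
    unfolding trivial_critical_ideal_def P.genideal_one by (simp add: int_poly_ring_one_closed)
  moreover have "critical_ideal D i \<subseteq> {p \<in> carrier (int_poly_ring (verts D)). poly_eval x p = 0}"
    unfolding critical_ideal_def using assms laplacian_minors_closed
    by (intro P.genideal_minimal ideal_poly_eval_zero) blast
  ultimately show False by (auto simp: poly_eval_1)
qed

lemma (in digraph) arc_mult_eq: "arc_mult G u v = (if (u, v) \<in> arcs_ends G then 1 else 0)"
proof (cases "(u, v) \<in> arcs_ends G")
  case True
  then obtain e where e: "e \<in> arcs G" "arc_to_ends G e = (u, v)"
    by (auto simp: arcs_ends_def)
  then have "{e \<in> arcs G. tail G e = u \<and> head G e = v} = {e}"
    using no_multi_arcs by (auto simp: arc_to_ends_def)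
  with True show ?thesis by (simp add: arc_mult_def)
next
  case False
  then have "{e \<in> arcs G. tail G e = u \<and> head G e = v} = {}"
    by (auto simp: arcs_ends_def arc_to_ends_def)
  with False show ?thesis by (simp add: arc_mult_def)
qed

lemma (in digraph) gen_laplacian_off_diagonal:
  "u \<noteq> v \<Longrightarrow> gen_laplacian G u v = (if (u, v) \<in> arcs_ends G then - 1 else 0)"
  by (simp add: gen_laplacian_def arc_mult_eq)

text \<open>
  A failure of the exchange property puts a zero at \<open>(u, v)\<close>, above the diagonal of the minor with rows
  \<open>u, b\<close> and columns \<open>a, v\<close>. The entry below the diagonal does not affect the determinant, so the
  cases \<open>a = b\<close>, where it is an indeterminate, and \<open>a \<noteq> b\<close> are treated alike.
\<close>
lemma (in digraph) not_arc_exchange_imp_corank: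
  assumes "\<not> arc_exchange (arcs_ends G)"
  shows "2 \<le> algebraic_corank G"
proof -
  obtain u a b v where ua: "(u, a) \<in> arcs_ends G" and bv: "(b, v) \<in> arcs_ends G"
    and uv: "u \<noteq> v" and nuv: "(u, v) \<notin> arcs_ends G"
    using assms unfolding arc_exchange_def by blast
  have neq: "u \<noteq> a" "b \<noteq> v" "u \<noteq> b" "a \<noteq> v"
    using ua bv nuv no_loop_arcs_ends by auto
  have V: "u \<in> verts G" "a \<in> verts G" "b \<in> verts G" "v \<in> verts G" using ua bv by auto
  let ?L = "gen_laplacian G"
  have L: "?L u a = - 1" "?L u v = 0" "?L b v = - 1"
    using ua bv nuv uv neq by (simp_all add: gen_laplacian_off_diagonal)
  have "laplacian_minor G [u] [a] = - 1"
    unfolding laplacian_minor_def using L by (subst det_single) auto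
  moreover have "laplacian_minor G [u] [a] \<in> laplacian_minors G 1"
    unfolding laplacian_minors_def using V by (intro CollectI exI[of _ "[u]"] exI[of _ "[a]"]) simp
  ultimately have t1: "trivial_critical_ideal G 1"
    by (intro trivial_critical_idealI[of "- 1"]) auto
  let ?M = "mat 2 2 (\<lambda>(i, j). ?L ([u, b] ! i) ([a, v] ! j))"
  have "det ?M = prod_list (diag_mat ?M)"
  proof (rule det_lower_triangular)
    fix i j :: nat assume "i < j" "j < 2"
    then have "i = 0" "j = 1" by auto
    then show "?M $$ (i, j) = 0" using L by simp
  qed simp
  then have "laplacian_minor G [u, b] [a, v] = 1"
    using L by (simp add: laplacian_minor_def diag_mat_def numeral_2_eq_2)
  moreover have "laplacian_minor G [u, b] [a, v] \<in> laplacian_minors G 2"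
    unfolding laplacian_minors_def using V neq
    by (intro CollectI exI[of _ "[u, b]"] exI[of _ "[a, v]"]) simp
  ultimately have t2: "trivial_critical_ideal G 2"
    by (intro trivial_critical_idealI[of 1]) auto
  have "card {u, v} \<le> card (verts G)" using V finite_verts by (intro card_mono) auto
  then have "{1, 2} \<subseteq> {i \<in> {1..card (verts G)}. trivial_critical_ideal G i}"
    using uv t1 t2 by auto
  then have "card {1, 2 :: nat} \<le> algebraic_corank G"
    unfolding algebraic_corank_def by (intro card_mono) auto
  then show ?thesis by simp
qed

lemma det_outer_product:
  fixes r c :: "nat \<Rightarrow> 'a :: comm_ring_1"
  assumes "2 \<le> n"
  shows "det (mat n n (\<lambda>(i, j). r i * c j)) = 0"
proof -
  have "mat n n (\<lambda>(i, j). r i * c j) = mat\<^sub>r n n (\<lambda>i. r i \<cdot>\<^sub>v vec n c)"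
    by (intro eq_matI) auto
  also have "det \<dots> = prod r {0..<n} * det (mat\<^sub>r n n (\<lambda>i. vec n c))"
    by (rule det_rows_mul) auto
  also have "det (mat\<^sub>r n n (\<lambda>i. vec n c)) = 0"
    using assms by (intro det_identical_rows[of _ n 0 1]) auto
  finally show ?thesis by simp
qed

text \<open>
  The value of \<open>x_u\<close> is chosen so that the diagonal continues the rank one pattern of the
  off-diagonal entries.
\<close>
lemma (in digraph) arc_exchange_imp_not_trivial:
  assumes ex: "arc_exchange (arcs_ends G)" and i: "2 \<le> i"
  shows "\<not> trivial_critical_ideal G i"
proof -
  let ?R = "arcs_ends G"
  define r where "r u = (if u \<in> Domain ?R then - 1 else 0 :: int)" for u
  define c where "c v = (if v \<in> Range ?R then 1 else 0 :: int)" for v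
  let ?x = "\<lambda>u. r u * c u"
  have entry: "poly_eval ?x (gen_laplacian G u v) = r u * c v" for u v
  proof (cases "u = v")
    case True
    then show ?thesis by (simp add: gen_laplacian_def poly_eval_indet)
  next
    case False
    then have "(u, v) \<in> ?R \<longleftrightarrow> u \<in> Domain ?R \<and> v \<in> Range ?R"
      using arc_exchangeD[OF ex] by blast
    with False show ?thesis
      by (auto simp: gen_laplacian_off_diagonal r_def c_def poly_eval.hom_uminus poly_eval_0 poly_eval_1)
  qed
  show ?thesis
  proof (rule not_trivial_critical_idealI)
    fix p assume "p \<in> laplacian_minors G i"
    then obtain rs cs where p: "p = laplacian_minor G rs cs" and len: "length rs = i" "length cs = i"
      unfolding laplacian_minors_def by blast
    let ?M = "mat i i (\<lambda>(a, b). gen_laplacian G (rs ! a) (cs ! b))"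
    have "poly_eval ?x p = det (map_mat (poly_eval ?x) ?M)"
      by (simp add: p laplacian_minor_def len poly_eval.hom_det)
    also have "map_mat (poly_eval ?x) ?M = mat i i (\<lambda>(a, b). r (rs ! a) * c (cs ! b))"
      by (intro eq_matI) (simp_all add: entry)
    also have "det \<dots> = 0" by (rule det_outer_product[OF i])
    finally show "poly_eval ?x p = 0" .
  qed
qed

lemma (in digraph) corank_le_1_iff_arc_exchange:
  "algebraic_corank G \<le> 1 \<longleftrightarrow> arc_exchange (arcs_ends G)"
proof
  assume ex: "arc_exchange (arcs_ends G)"
  have "i = 1" if "i \<in> {1..card (verts G)}" "trivial_critical_ideal G i" for i
    using that arc_exchange_imp_not_trivial[OF ex, of i] by (cases "2 \<le> i") auto
  then have "{i \<in> {1..card (verts G)}. trivial_critical_ideal G i} \<subseteq> {1}" by blast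
  then have "algebraic_corank G \<le> card {1 :: nat}"
    unfolding algebraic_corank_def by (intro card_mono) simp_all
  then show "algebraic_corank G \<le> 1" by simp
qed (use not_arc_exchange_imp_corank in fastforce)

theorem theorem3p3:
  fixes D :: "('a, 'b) pre_digraph"
  assumes "digraph D" and "Digraph_Component.connected D"
  shows "(D \<in> Gamma_le 1 \<longleftrightarrow> family_free forbidden_family D) \<and>
         (family_free forbidden_family D \<longleftrightarrow>
            (\<exists>n1 n2 n3. digraph_iso D (Lambda n1 n2 n3)))"
proof -
  interpret digraph D by fact
  have "D \<in> Gamma_le 1 \<longleftrightarrow> arc_exchange (arcs_ends D)"
    using assms unfolding Gamma_le_def corank_le_1_iff_arc_exchange[symmetric] by simp
  moreover have "family_free forbidden_family D \<longleftrightarrow> arc_exchange (arcs_ends D)"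
    using family_free_imp_arc_exchange[OF assms(2)]
      arc_exchange_imp_family_free[OF assms(1) _ forbidden_family_not_exchange] by blast
  moreover have "(\<exists>n1 n2 n3. digraph_iso D (Lambda n1 n2 n3)) \<longleftrightarrow> arc_exchange (arcs_ends D)"
    using arc_exchange_imp_iso_Lambda[OF assms(2)] iso_Lambda_imp_arc_exchange by blast
  ultimately show ?thesis by blast
qed

end
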